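(* Let $(y_k),(g_k),(t_k),(s_k)$ be generated by the first-order meta-algorithm described in the context, under the assumptions stated there, and let $x_k,u_k,d_k,\theta_k$ and $\mathcal{D}$ be as defined in the context. Suppose the stepsizes $t_k$ are such that, for real numbers $\epsilon_k$, $$t_k\mathcal{D}(x_k, y_k,s_{k},\theta_k)/\theta_k - D_h(s_{k},s_{k-1}) \le \epsilon_k, \qquad k=0,1,2,\dots.$$ Then $$f(Ax_k) + \Psi(x_k) + f^*(u_k) + (\Psi+d_k)^*(-A^*u_k) \le \frac{\sum_{i=0}^{k-1}\epsilon_i}{\sum_{i=0}^{k-1} t_i}, \qquad k=1,2,\dots.$$ In particular, for $k=1,2,\dots$, $$f(Ax_k) +\Psi(x_k) - (f(Ax) + \Psi(x))\le \frac{D_h( x, x_0) +\sum_{i=0}^{k-1} \epsilon_i }{\sum_{i=0}^{k-1} t_i}$$ for all $x \in E$.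
   Context: Setting. $E$ and $F$ are real vector spaces with continuous dual spaces $E^*,F^*$ and duality pairings $\langle\cdot,\cdot\rangle$; $A:E\to F$ is a linear mapping with adjoint $A^*:F^*\to E^*$; $f:F\to\mathbb{R}\cup\{\infty\}$ and $\Psi:E\to\mathbb{R}\cup\{\infty\}$ are closed convex functions with $\mathrm{dom}(\Psi)\subseteq \mathrm{dom}(\partial(f\circ A))$; $h:E\to\mathbb{R}\cup\{\infty\}$ is a convex differentiable reference function (not necessarily strictly convex) with $\mathrm{dom}(\Psi)\subseteq\overline{\mathrm{dom}(h)}$. For a function $\phi$, $\phi^*$ denotes its convex conjugate, $\phi^*(v)=\sup_x\{\langle v,x\rangle-\phi(x)\}$. The Bregman distance of $h$ is $D_h(s,z)=h(s)-h(z)-\langle\nabla h(z),s-z\rangle$ (equal to $+\infty$ when $s\notin\mathrm{dom}(h)$). First-order meta-algorithm. Input $s_{-1}\in\mathrm{dom}(\Psi)\cap\mathrm{dom}(h)$. For $k=0,1,2,\dots$: pick any $y_k\in\mathrm{dom}(\partial(f\circ A))$ and $g_k\in\partial f(Ay_k)$; pick $t_k>0$; pick $s_k\in\mathrm{argmin}_s\{t_k(\langle A^*g_k,s\rangle+\Psi(s))+D_h(s,s_{k-1})\}$. Standing assumption. At each iteration $k$ the minimizer $s_k$ exists and satisfies the optimality conditions $t_k(A^*g_k+g_k^\Psi)+\nabla h(s_k)-\nabla h(s_{k-1})=0$ for some $g_k^\Psi\in\partial\Psi(s_k)$. Derived sequences. $x_0:=s_{-1}$ and, for $k\ge1$, $$x_k=\frac{\sum_{i=0}^{k-1}t_is_i}{\sum_{i=0}^{k-1}t_i},\quad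 u_k=\frac{\sum_{i=0}^{k-1}t_ig_i}{\sum_{i=0}^{k-1}t_i},\quad d_k(s)=\frac{D_h(s,s_{-1})}{\sum_{i=0}^{k-1}t_i};$$ for $k\ge0$, $\theta_k=t_k/\sum_{i=0}^kt_i$. The function $\mathcal{D}$. For $x,s\in\mathrm{dom}(\Psi)$, $y\in\mathrm{dom}(\partial(f\circ A))$, $\theta\in[0,1]$, $$\mathcal{D}(x,y,s,\theta)=(f\circ A+\Psi)(x+\theta(s-x))-(1-\theta)(f\circ A+\Psi)(x)-\theta(f\circ A+\Psi)(s)+\theta D_{f\circ A}(s,y),$$ where $D_{f\circ A}(s,y)=f(As)-f(Ay)-\langle g,A(s-y)\rangle$ for a given $g\in\partial f(Ay)$; in $\mathcal{D}(x_k,y_k,s_k,\theta_k)$ the subgradient used is $g=g_k$. *)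

theory Defs
  imports "HOL-Analysis.Analysis"
begin

(* Real topological vector spaces (not assumed Hausdorff, locally convex or normed). *)
class real_tvs = real_vector + topological_ab_group_add +
  assumes tendsto_scaleR_nhds:
    "((\<lambda>p. fst p *\<^sub>R snd p) \<longlongrightarrow> r *\<^sub>R x) (nhds r \<times>\<^sub>F nhds x)"

instance real_normed_vector < real_tvs
proof
  fix r :: real and x :: 'a
  show "((\<lambda>p. fst p *\<^sub>R snd p) \<longlongrightarrow> r *\<^sub>R x) (nhds r \<times>\<^sub>F nhds x)"
    unfolding nhds_prod[symmetric]
    by (intro tendsto_scaleR tendsto_fst[where a = "(r, x)", simplified]
        tendsto_snd[where a = "(r, x)", simplified]) (simp_all add: filterlim_ident)
qed

(* Dual elements are plain functions; the pairing of v with x is the application v x. *)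
definition cdual :: "('a::real_tvs \<Rightarrow> real) set" where
  "cdual = {v. linear v \<and> continuous_on UNIV v}"

definition adjoint_map :: "('a \<Rightarrow> 'b) \<Rightarrow> ('b \<Rightarrow> real) \<Rightarrow> 'a \<Rightarrow> real" where
  "adjoint_map A v = (\<lambda>x. v (A x))"

definition edom :: "('a \<Rightarrow> ereal) \<Rightarrow> 'a set" where
  "edom \<phi> = {x. \<phi> x < \<infinity>}"

definition epi :: "('a \<Rightarrow> ereal) \<Rightarrow> ('a \<times> real) set" where
  "epi \<phi> = {(x, r). \<phi> x \<le> ereal r}"

(* Convex functions with values in the reals extended by plus infinity. *)
definition convex_fun :: "('a::real_tvs \<Rightarrow> ereal) \<Rightarrow> bool" where
  "convex_fun \<phi> \<longleftrightarrow> (\<forall>x. \<phi> x \<noteq> -\<infinity>) \<and> convex (epi \<phi>)"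

definition closed_convex_fun :: "('a::real_tvs \<Rightarrow> ereal) \<Rightarrow> bool" where
  "closed_convex_fun \<phi> \<longleftrightarrow> convex_fun \<phi> \<and> closed (epi \<phi>)"

definition conjugate :: "('a \<Rightarrow> ereal) \<Rightarrow> ('a \<Rightarrow> real) \<Rightarrow> ereal" where
  "conjugate \<phi> v = (SUP x. ereal (v x) - \<phi> x)"

definition subdiff :: "('a::real_tvs \<Rightarrow> ereal) \<Rightarrow> 'a \<Rightarrow> ('a \<Rightarrow> real) set" where
  "subdiff \<phi> x = {g \<in> cdual. \<bar>\<phi> x\<bar> \<noteq> \<infinity> \<and> (\<forall>z. \<phi> x + ereal (g (z - x)) \<le> \<phi> z)}"

definition dom_subdiff :: "('a::real_tvs \<Rightarrow> ereal) \<Rightarrow> 'a set" where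
  "dom_subdiff \<phi> = {x. subdiff \<phi> x \<noteq> {}}"

(* Gateaux gradient: no norm is available on the space, and in a normed space it is implied by
   (and equal to) the Frechet gradient.  The limit is taken in ereal and is finite, so it forces
   \<phi> to be finite near z on every line through z. *)
definition has_gradient :: "('a::real_tvs \<Rightarrow> ereal) \<Rightarrow> ('a \<Rightarrow> real) \<Rightarrow> 'a \<Rightarrow> bool" where
  "has_gradient \<phi> G z \<longleftrightarrow> G \<in> cdual \<and> \<bar>\<phi> z\<bar> \<noteq> \<infinity> \<and>
     (\<forall>v. ((\<lambda>r. (\<phi> (z + r *\<^sub>R v) - \<phi> z) / ereal r) \<longlongrightarrow> ereal (G v)) (at 0))"

definition differentiable_at :: "('a::real_tvs \<Rightarrow> ereal) \<Rightarrow> 'a \<Rightarrow> bool" where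
  "differentiable_at \<phi> z \<longleftrightarrow> (\<exists>G. has_gradient \<phi> G z)"

definition grad :: "('a::real_tvs \<Rightarrow> ereal) \<Rightarrow> 'a \<Rightarrow> 'a \<Rightarrow> real" where
  "grad \<phi> z = (THE G. has_gradient \<phi> G z)"

lemma grad_eq:
  assumes "has_gradient \<phi> G z"
  shows "grad \<phi> z = G"
  unfolding grad_def
proof (rule the_equality[where P = "\<lambda>G. has_gradient \<phi> G z", OF assms])
  fix G' assume "has_gradient \<phi> G' z"
  then have "ereal (G' v) = ereal (G v)" for v
    using assms unfolding has_gradient_def by (meson tendsto_unique at_neq_bot)
  then show "G' = G" by auto
qed

(* Intended for z at which h is differentiable; it is then infinite exactly for s outside edom h. *)
definition bregman :: "('a::real_tvs \<Rightarrow> ereal) \<Rightarrow> 'a \<Rightarrow> 'a \<Rightarrow> ereal" where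
  "bregman h s z = h s - h z - ereal (grad h z (s - z))"

(* Requiring differentiability only on the interior of the domain admits references such as the
   negative entropy on the closed orthant.  It is implied by differentiability on all of edom h. *)
definition reference_fun :: "('a::real_tvs \<Rightarrow> ereal) \<Rightarrow> bool" where
  "reference_fun h \<longleftrightarrow> convex_fun h \<and> (\<forall>z \<in> interior (edom h). differentiable_at h z)"

(* The iterates s are indexed by integers from -1 on; y, g, t are indexed from 0. *)
definition meta_algorithm ::
  "('a::real_tvs \<Rightarrow> 'b::real_tvs) \<Rightarrow> ('b \<Rightarrow> ereal) \<Rightarrow> ('a \<Rightarrow> ereal) \<Rightarrow> ('a \<Rightarrow> ereal) \<Rightarrow>
   (nat \<Rightarrow> 'a) \<Rightarrow> (nat \<Rightarrow> 'b \<Rightarrow> real) \<Rightarrow> (nat \<Rightarrow> real) \<Rightarrow> (int \<Rightarrow> 'a) \<Rightarrow> bool" where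
  "meta_algorithm A f \<Psi> h y g t s \<longleftrightarrow>
     s (-1) \<in> edom \<Psi> \<inter> edom h \<and>
     (\<forall>k. y k \<in> dom_subdiff (f \<circ> A) \<and> g k \<in> subdiff f (A (y k)) \<and> t k > 0 \<and>
          is_arg_min (\<lambda>z. ereal (t k) * (ereal (adjoint_map A (g k) z) + \<Psi> z)
                            + bregman h z (s (int k - 1)))
            (\<lambda>_. True) (s (int k)))"

(* The equation in the dual is written pointwise.  The gradients occurring in it are required to
   exist; this is automatic if h is differentiable on edom h. *)
definition optimality_conditions ::
  "('a::real_tvs \<Rightarrow> 'b::real_tvs) \<Rightarrow> ('a \<Rightarrow> ereal) \<Rightarrow> ('a \<Rightarrow> ereal) \<Rightarrow>
   (nat \<Rightarrow> 'b \<Rightarrow> real) \<Rightarrow> (nat \<Rightarrow> real) \<Rightarrow> (int \<Rightarrow> 'a) \<Rightarrow> bool" where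
  "optimality_conditions A \<Psi> h g t s \<longleftrightarrow>
     (\<forall>k. differentiable_at h (s (int k)) \<and> differentiable_at h (s (int k - 1)) \<and>
          (\<exists>g\<Psi> \<in> subdiff \<Psi> (s (int k)). \<forall>v.
             t k * (adjoint_map A (g k) v + g\<Psi> v)
               + grad h (s (int k)) v - grad h (s (int k - 1)) v = 0))"

definition x_seq :: "(nat \<Rightarrow> real) \<Rightarrow> (int \<Rightarrow> 'a::real_vector) \<Rightarrow> nat \<Rightarrow> 'a" where
  "x_seq t s k =
     (if k = 0 then s (-1) else (\<Sum>i<k. t i *\<^sub>R s (int i)) /\<^sub>R (\<Sum>i<k. t i))"

definition u_seq :: "(nat \<Rightarrow> real) \<Rightarrow> (nat \<Rightarrow> 'b \<Rightarrow> real) \<Rightarrow> nat \<Rightarrow> 'b \<Rightarrow> real" where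
  "u_seq t g k = (\<lambda>w. (\<Sum>i<k. t i * g i w) / (\<Sum>i<k. t i))"

definition d_seq ::
  "('a::real_tvs \<Rightarrow> ereal) \<Rightarrow> (nat \<Rightarrow> real) \<Rightarrow> (int \<Rightarrow> 'a) \<Rightarrow> nat \<Rightarrow> 'a \<Rightarrow> ereal" where
  "d_seq h t s k = (\<lambda>z. bregman h z (s (-1)) / ereal (\<Sum>i<k. t i))"

definition theta_seq :: "(nat \<Rightarrow> real) \<Rightarrow> nat \<Rightarrow> real" where
  "theta_seq t k = t k / (\<Sum>i\<le>k. t i)"

definition bregman_comp ::
  "('a::real_tvs \<Rightarrow> 'b::real_tvs) \<Rightarrow> ('b \<Rightarrow> ereal) \<Rightarrow> ('b \<Rightarrow> real) \<Rightarrow> 'a \<Rightarrow> 'a \<Rightarrow> ereal" where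
  "bregman_comp A f g s y = f (A s) - f (A y) - ereal (g (A (s - y)))"

(* The additional argument g is the subgradient of f at A y used in the Bregman term. *)
definition D_fun ::
  "('a::real_tvs \<Rightarrow> 'b::real_tvs) \<Rightarrow> ('b \<Rightarrow> ereal) \<Rightarrow> ('a \<Rightarrow> ereal) \<Rightarrow> ('b \<Rightarrow> real) \<Rightarrow>
   'a \<Rightarrow> 'a \<Rightarrow> 'a \<Rightarrow> real \<Rightarrow> ereal" where
  "D_fun A f \<Psi> g x y s \<theta> =
     (let F = (\<lambda>z. f (A z) + \<Psi> z) in
        F (x + \<theta> *\<^sub>R (s - x)) - ereal (1 - \<theta>) * F x - ereal \<theta> * F s
          + ereal \<theta> * bregman_comp A f g s y)"

end

theory Submission
  imports Defs
begin

text \<open>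
  Write \<open>F = f \<circ> A + \<Psi>\<close>, \<open>T\<^sub>k\<close> for the sum of the first \<open>k\<close> stepsizes, and
  \<open>m\<^sub>k(z) = f (A y\<^sub>k) + \<langle>g\<^sub>k, A (z - y\<^sub>k)\<rangle> + \<Psi> z\<close> for the model of \<open>F\<close> minimized, up to the proximal
  term, in step \<open>k\<close>.  Since \<open>t\<^sub>k / \<theta>\<^sub>k = T\<^sub>k\<^sub>+\<^sub>1\<close> and
  \<open>x\<^sub>k\<^sub>+\<^sub>1 = x\<^sub>k + \<theta>\<^sub>k (s\<^sub>k - x\<^sub>k)\<close>, the stepsize condition says
  \<open>T\<^sub>k\<^sub>+\<^sub>1 F(x\<^sub>k\<^sub>+\<^sub>1) - T\<^sub>k F(x\<^sub>k) \<le> t\<^sub>k m\<^sub>k(s\<^sub>k) + D\<^sub>h(s\<^sub>k, s\<^sub>k\<^sub>-\<^sub>1) + \<epsilon>\<^sub>k\<close>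
  (lemma \<open>D_fun_linear_model\<close>).  By optimality of \<open>s\<^sub>k\<close> the first two terms on the right-hand
  side do not decrease when they are replaced by \<open>t\<^sub>k m\<^sub>k(z) + D\<^sub>h(z, s\<^sub>k\<^sub>-\<^sub>1) - D\<^sub>h(z, s\<^sub>k)\<close> for any comparison point \<open>z\<close>
  (lemma \<open>bregman_prox_inequality\<close>).  Summation over \<open>k\<close> telescopes both the objective values and the
  Bregman distances (lemma \<open>weighted_objective_le_model\<close>), and the last distance is discarded because
  it is nonnegative.

  The constant part of \<open>m\<^sub>k\<close> is \<open>f (A y\<^sub>k) - \<langle>g\<^sub>k, A y\<^sub>k\<rangle> = - f\<^sup>* (g\<^sub>k)\<close>, and convexity of \<open>f\<^sup>*\<close> bounds
  \<open>f\<^sup>* (u\<^sub>k)\<close> by the weighted average of these conjugate values (lemma \<open>conjugate_u_seq_le\<close>).  After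
  division by \<open>T\<^sub>k\<close>, the supremum over \<open>z\<close> of the remaining terms is \<open>(\<Psi> + d\<^sub>k)\<^sup>* (- A\<^sup>* u\<^sub>k)\<close>, which
  gives the primal-dual estimate.  Taking \<open>z = x\<close> and bounding the averaged affine minorants of \<open>f\<close> at
  \<open>A x\<close> by \<open>f (A x)\<close> instead gives the primal one.
\<close>

section \<open>Convex functions and Bregman distances\<close>

lemma convex_fun_combination_le:
  fixes \<phi> :: "'a::real_tvs \<Rightarrow> ereal"
  assumes "convex_fun \<phi>" "\<phi> x = ereal a" "\<phi> y = ereal b" "0 \<le> r" "r \<le> 1"
  shows "\<phi> (x + r *\<^sub>R (y - x)) \<le> ereal (a + r * (b - a))"
proof -
  have "convex (epi \<phi>)" "(x, a) \<in> epi \<phi>" "(y, b) \<in> epi \<phi>"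
    using assms by (auto simp: convex_fun_def epi_def)
  then have "(1 - r) *\<^sub>R (x, a) + r *\<^sub>R (y, b) \<in> epi \<phi>"
    using assms by (intro convexD) auto
  moreover have "(1 - r) *\<^sub>R (x, a) + r *\<^sub>R (y, b) = (x + r *\<^sub>R (y - x), a + r * (b - a))"
    by (simp add: algebra_simps)
  ultimately show ?thesis
    by (simp add: epi_def)
qed

lemma convex_fun_finite_on_edom:
  assumes "convex_fun \<phi>" "x \<in> edom \<phi>"
  shows "\<phi> x = ereal (real_of_ereal (\<phi> x))"
  using assms by (cases "\<phi> x") (auto simp: convex_fun_def edom_def)

lemma convex_edom:
  fixes \<phi> :: "'a::real_tvs \<Rightarrow> ereal"
  assumes "convex_fun \<phi>"
  shows "convex (edom \<phi>)"
  unfolding convex_alt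
proof (intro ballI allI impI)
  fix x y and r :: real
  assume "x \<in> edom \<phi>" "y \<in> edom \<phi>" "0 \<le> r \<and> r \<le> 1"
  then have "\<phi> (x + r *\<^sub>R (y - x))
      \<le> ereal (real_of_ereal (\<phi> x) + r * (real_of_ereal (\<phi> y) - real_of_ereal (\<phi> x)))"
    using convex_fun_finite_on_edom[OF assms] by (intro convex_fun_combination_le[OF assms]) auto
  then have "\<phi> (x + r *\<^sub>R (y - x)) < \<infinity>"
    using less_ereal.simps(4) order_le_less_trans by blast
  moreover have "(1 - r) *\<^sub>R x + r *\<^sub>R y = x + r *\<^sub>R (y - x)"
    by (simp add: algebra_simps)
  ultimately show "(1 - r) *\<^sub>R x + r *\<^sub>R y \<in> edom \<phi>"
    by (simp add: edom_def)
qed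

lemma cdual_diff:
  assumes "v \<in> cdual"
  shows "v (x - y) = v x - v y"
  using assms by (auto simp: cdual_def linear_diff)

lemma subdiff_le:
  assumes "v \<in> subdiff \<phi> x"
  shows "ereal (real_of_ereal (\<phi> x) + (v z - v x)) \<le> \<phi> z"
proof -
  have "v \<in> cdual" "\<bar>\<phi> x\<bar> \<noteq> \<infinity>" "\<phi> x + ereal (v (z - x)) \<le> \<phi> z"
    using assms by (auto simp: subdiff_def)
  then show ?thesis
    by (cases "\<phi> x") (auto simp: cdual_diff)
qed

text \<open>The difference quotient of a convex function along a segment is bounded by the increment
  over the whole segment, and the derivative is the limit of these quotients from the right.\<close>

lemma gradient_inequality:
  fixes h :: "'a::real_tvs \<Rightarrow> ereal"
  assumes convex: "convex_fun h" and gradient: "has_gradient h G z" and finite: "h x = ereal b"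
  shows "real_of_ereal (h z) + G (x - z) \<le> b"
proof -
  obtain a where a: "h z = ereal a"
    using gradient by (cases "h z") (auto simp: has_gradient_def)
  have "((\<lambda>r. (h (z + r *\<^sub>R (x - z)) - h z) / ereal r) \<longlongrightarrow> ereal (G (x - z))) (at_right 0)"
    using gradient unfolding has_gradient_def by (meson filterlim_at_split)
  moreover have "\<forall>\<^sub>F r in at_right 0. (h (z + r *\<^sub>R (x - z)) - h z) / ereal r \<le> ereal (b - a)"
    unfolding eventually_at_right_field
  proof (intro exI[of _ 1] conjI allI impI)
    fix r :: real
    assume r: "0 < r" "r < 1"
    have "h (z + r *\<^sub>R (x - z)) \<le> ereal (a + r * (b - a))"
      using convex_fun_combination_le[OF convex a finite] r by simp
    then show "(h (z + r *\<^sub>R (x - z)) - h z) / ereal r \<le> ereal (b - a)"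
      using r by (cases "h (z + r *\<^sub>R (x - z))") (auto simp: a field_simps)
  qed simp
  ultimately have "ereal (G (x - z)) \<le> ereal (b - a)"
    by (rule tendsto_upperbound) simp
  then show ?thesis
    by (simp add: a)
qed

lemma has_gradient_grad:
  assumes "differentiable_at h z"
  shows "has_gradient h (grad h z) z"
  using assms grad_eq unfolding differentiable_at_def by blast

lemma bregman_finite:
  assumes "differentiable_at h z" "h x = ereal b"
  shows "bregman h x z = ereal (b - real_of_ereal (h z) - (grad h z x - grad h z z))"
proof -
  have "\<bar>h z\<bar> \<noteq> \<infinity>" "grad h z \<in> cdual"
    using has_gradient_grad[OF assms(1)] by (auto simp: has_gradient_def)
  then show ?thesis
    by (cases "h z") (auto simp: bregman_def assms cdual_diff)
qed

lemma bregman_nonneg: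
  assumes "convex_fun h" "differentiable_at h z" "h x = ereal b"
  shows "0 \<le> real_of_ereal (bregman h x z)"
  using gradient_inequality[OF assms(1) has_gradient_grad[OF assms(2)] assms(3)]
    has_gradient_grad[OF assms(2)]
  by (auto simp: bregman_finite[OF assms(2,3)] has_gradient_def cdual_diff)

text \<open>The optimality condition says that the decrease of the gradient of \<open>h\<close> from \<open>p\<close> to \<open>q\<close> is
  \<open>\<tau>\<close> times a subgradient of \<open>l + \<Psi>\<close> at \<open>q\<close>, so the three-point identity for Bregman distances turns the
  subgradient inequality into the usual estimate for a proximal step.\<close>

lemma bregman_prox_inequality:
  assumes h: "differentiable_at h p" "differentiable_at h q" "h z = ereal hz"
    and \<Psi>: "v \<in> subdiff \<Psi> q" "\<Psi> z = ereal b" and \<tau>: "0 < \<tau>"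
    and optimal: "\<And>w. \<tau> * (l w + v w) + grad h q w - grad h p w = 0"
  shows "\<tau> * (l q + real_of_ereal (\<Psi> q)) + real_of_ereal (bregman h q p)
            + real_of_ereal (bregman h z q)
         \<le> \<tau> * (l z + b) + real_of_ereal (bregman h z p)"
proof -
  obtain hq where hq: "h q = ereal hq"
    using has_gradient_grad[OF h(2)] by (cases "h q") (auto simp: has_gradient_def)
  have "real_of_ereal (\<Psi> q) + (v z - v q) \<le> b"
    using subdiff_le[OF \<Psi>(1), of z] by (simp add: \<Psi>(2))
  then have "\<tau> * (real_of_ereal (\<Psi> q) + (v z - v q)) \<le> \<tau> * b"
    using \<tau> by simp
  then show ?thesis
    using optimal[of z] optimal[of q]
    by (simp add: bregman_finite[OF h(1) hq] bregman_finite[OF h(1,3)] bregman_finite[OF h(2,3)]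
        hq algebra_simps)
qed

section \<open>The stepsize condition and the averaged sequences\<close>

text \<open>The term with \<open>f (A s)\<close> cancels: the function measures how far the objective at the convex
  combination exceeds the combination of its value at \<open>x\<close> with the linear model at \<open>s\<close>.\<close>

lemma D_fun_linear_model:
  assumes A: "linear A" and subgradient: "g \<in> subdiff f (A y)"
    and finite: "\<And>z. z \<in> {x, s, x + \<theta> *\<^sub>R (s - x)} \<Longrightarrow> \<bar>f (A z)\<bar> \<noteq> \<infinity> \<and> \<bar>\<Psi> z\<bar> \<noteq> \<infinity>"
  shows "D_fun A f \<Psi> g x y s \<theta> = ereal
    (real_of_ereal (f (A (x + \<theta> *\<^sub>R (s - x))) + \<Psi> (x + \<theta> *\<^sub>R (s - x)))
      - (1 - \<theta>) * real_of_ereal (f (A x) + \<Psi> x)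
      - \<theta> * (real_of_ereal (f (A y)) + (g (A s) - g (A y)) + real_of_ereal (\<Psi> s)))"
proof -
  have g: "g (A (s - y)) = g (A s) - g (A y)"
    using subgradient by (simp add: linear_diff[OF A] subdiff_def cdual_diff)
  obtain a where "f (A y) = ereal a"
    using subgradient by (cases "f (A y)") (auto simp: subdiff_def)
  moreover obtain b c where "f (A x) = ereal b" "\<Psi> x = ereal c"
    using finite[of x] by (cases "f (A x)"; cases "\<Psi> x") auto
  moreover obtain b c where "f (A s) = ereal b" "\<Psi> s = ereal c"
    using finite[of s] by (cases "f (A s)"; cases "\<Psi> s") auto
  moreover obtain b c where "f (A (x + \<theta> *\<^sub>R (s - x))) = ereal b"
      "\<Psi> (x + \<theta> *\<^sub>R (s - x)) = ereal c"
    using finite[of "x + \<theta> *\<^sub>R (s - x)"]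
    by (cases "f (A (x + \<theta> *\<^sub>R (s - x)))"; cases "\<Psi> (x + \<theta> *\<^sub>R (s - x))") auto
  ultimately show ?thesis
    unfolding D_fun_def bregman_comp_def Let_def g by (simp add: right_diff_distrib distrib_left)
qed

text \<open>The weight \<open>theta_seq t k\<close> is the share of the newest iterate in the new average, so the
  averages move by convex combinations of exactly the form that occurs in \<open>D_fun\<close>.\<close>

lemma x_seq_Suc:
  assumes "\<And>i. 0 < t i"
  shows "x_seq t s (Suc k) = x_seq t s k + theta_seq t k *\<^sub>R (s (int k) - x_seq t s k)"
proof (cases "k = 0")
  case True
  then show ?thesis
    using assms[of 0] by (simp add: x_seq_def theta_seq_def)
next
  case False
  define T where "T = (\<Sum>i<k. t i)"
  define S where "S = (\<Sum>i<k. t i *\<^sub>R s (int i))"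
  have T: "0 < T" "0 < T + t k"
    unfolding T_def using assms False by (auto intro!: sum_pos add_pos_pos)
  have "S = T *\<^sub>R x_seq t s k"
    using T False by (simp add: x_seq_def T_def S_def)
  moreover have "x_seq t s (Suc k) = (S + t k *\<^sub>R s (int k)) /\<^sub>R (T + t k)"
    by (simp add: x_seq_def T_def S_def)
  moreover have \<theta>: "theta_seq t k = t k / (T + t k)"
    by (simp add: theta_seq_def T_def lessThan_Suc_atMost[symmetric])
  moreover have "T / (T + t k) = 1 - theta_seq t k"
    using T unfolding \<theta> by (simp add: field_simps)
  ultimately have "x_seq t s (Suc k)
      = (1 - theta_seq t k) *\<^sub>R x_seq t s k + theta_seq t k *\<^sub>R s (int k)"
    by (simp add: scaleR_right_distrib divide_inverse_commute)
  then show ?thesis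
    by (simp add: algebra_simps)
qed

lemma theta_seq_bounds:
  assumes "\<And>i. 0 < t i"
  shows "0 < theta_seq t k" "theta_seq t k \<le> 1"
proof -
  have "0 \<le> (\<Sum>i<k. t i)"
    using assms by (simp add: sum_nonneg less_imp_le)
  then show "0 < theta_seq t k" "theta_seq t k \<le> 1"
    using assms[of k] by (simp_all add: theta_seq_def lessThan_Suc_atMost[symmetric])
qed

lemma x_seq_in_convex:
  assumes "convex C" "\<And>i. 0 < t i" "s (-1) \<in> C" "\<And>i. s (int i) \<in> C"
  shows "x_seq t s k \<in> C"
proof (induction k)
  case 0
  then show ?case
    using assms by (simp add: x_seq_def)
next
  case (Suc k)
  have "(1 - theta_seq t k) *\<^sub>R x_seq t s k + theta_seq t k *\<^sub>R s (int k) \<in> C"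
    using assms Suc theta_seq_bounds[where t = t and k = k] by (intro convexD) auto
  then show ?case
    by (simp add: x_seq_Suc[where t = t, OF assms(2)] algebra_simps)
qed

text \<open>A subgradient \<open>g i\<close> at \<open>p i\<close> is the slope of an affine minorant of \<open>f\<close> with intercept
  \<open>f (p i) - g i (p i)\<close>.  Averaging these minorants gives one with slope \<open>u_seq t g k\<close>, and the
  conjugate at a slope is at most the negated intercept of any such minorant.\<close>

lemma conjugate_u_seq_le:
  assumes subgradient: "\<And>i. g i \<in> subdiff f (p i)" and t: "\<And>i. 0 < t i" and k: "1 \<le> k"
  shows "conjugate f (u_seq t g k)
    \<le> ereal (- (\<Sum>i<k. t i * (real_of_ereal (f (p i)) - g i (p i))) / (\<Sum>i<k. t i))"
  unfolding conjugate_def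
proof (rule SUP_least)
  fix w
  define T where "T = (\<Sum>i<k. t i)"
  have T: "0 < T"
    unfolding T_def using t k by (auto intro!: sum_pos simp: lessThan_empty_iff)
  show "ereal (u_seq t g k w) - f w
    \<le> ereal (- (\<Sum>i<k. t i * (real_of_ereal (f (p i)) - g i (p i))) / (\<Sum>i<k. t i))"
  proof (cases "f w")
    case (real c)
    have "(\<Sum>i<k. t i * (real_of_ereal (f (p i)) + (g i w - g i (p i)))) \<le> (\<Sum>i<k. t i * c)"
      using subdiff_le[OF subgradient, of _ w] t
      by (intro sum_mono mult_left_mono) (simp_all add: real less_imp_le)
    then have "(\<Sum>i<k. t i * (real_of_ereal (f (p i)) - g i (p i))) + (\<Sum>i<k. t i * g i w) \<le> T * c"
      unfolding T_def sum_distrib_right sum.distrib[symmetric] by (simp add: algebra_simps)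
    then have "(\<Sum>i<k. t i * g i w) - T * c \<le> - (\<Sum>i<k. t i * (real_of_ereal (f (p i)) - g i (p i)))"
      by linarith
    then have "((\<Sum>i<k. t i * g i w) - T * c) / T
        \<le> - (\<Sum>i<k. t i * (real_of_ereal (f (p i)) - g i (p i))) / T"
      using T by (intro divide_right_mono) auto
    then show ?thesis
      using T by (simp add: real u_seq_def T_def[symmetric] diff_divide_distrib)
  next
    case MInf
    then show ?thesis
      using subdiff_le[OF subgradient, of _ w] by simp
  qed simp
qed

lemma iterate_in_edom:
  assumes "optimality_conditions A \<Psi> h g t s"
  shows "s (int k) \<in> edom \<Psi>"
proof -
  have "\<exists>v. v \<in> subdiff \<Psi> (s (int k))"
    using assms unfolding optimality_conditions_def by blast
  then show ?thesis
    by (auto simp: subdiff_def edom_def)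
qed

lemma x_seq_in_edom:
  assumes "convex_fun \<Psi>" "meta_algorithm A f \<Psi> h y g t s" "optimality_conditions A \<Psi> h g t s"
  shows "x_seq t s k \<in> edom \<Psi>"
  using assms(2)
  by (intro x_seq_in_convex convex_edom assms(1) iterate_in_edom[OF assms(3)])
    (simp_all add: meta_algorithm_def)

section \<open>Convergence of the meta-algorithm\<close>

text \<open>The step condition bounds the growth of the weighted objective by the linear model at the new
  iterate plus a Bregman distance and \<open>\<epsilon> k\<close>; the proximal inequality moves that model to an arbitrary
  comparison point \<open>z\<close> at the price of a telescoping difference of Bregman distances.\<close>

lemma weighted_objective_le_model:
  fixes A :: "'a::real_tvs \<Rightarrow> 'b::real_tvs" and s :: "int \<Rightarrow> 'a"
  assumes A: "linear A" and \<Psi>: "convex_fun \<Psi>" "edom \<Psi> \<subseteq> dom_subdiff (f \<circ> A)"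
    and algorithm: "meta_algorithm A f \<Psi> h y g t s"
    and optimality: "optimality_conditions A \<Psi> h g t s"
    and step: "\<And>k. ereal (t k) * D_fun A f \<Psi> (g k) (x_seq t s k) (y k) (s (int k)) (theta_seq t k)
                / ereal (theta_seq t k)
              - bregman h (s (int k)) (s (int k - 1)) \<le> ereal (\<epsilon> k)"
    and z: "\<Psi> z = ereal b" "h z = ereal c"
  shows "(\<Sum>i<k. t i) * real_of_ereal (f (A (x_seq t s k)) + \<Psi> (x_seq t s k))
            + real_of_ereal (bregman h z (s (int k - 1)))
    \<le> (\<Sum>i<k. t i * (real_of_ereal (f (A (y i))) + (g i (A z) - g i (A (y i))) + b))
        + real_of_ereal (bregman h z (s (-1))) + (\<Sum>i<k. \<epsilon> i)"
proof (induction k)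
  case 0
  show ?case
    by simp
next
  case (Suc k)
  have t: "0 < t i" for i
    using algorithm by (simp add: meta_algorithm_def)
  have subgradient: "g k \<in> subdiff f (A (y k))"
    using algorithm by (simp add: meta_algorithm_def)
  obtain v where v: "v \<in> subdiff \<Psi> (s (int k))"
      "\<And>w. t k * (g k (A w) + v w) + grad h (s (int k)) w - grad h (s (int k - 1)) w = 0"
    and h: "differentiable_at h (s (int k - 1))" "differentiable_at h (s (int k))"
    using optimality unfolding optimality_conditions_def adjoint_map_def by metis
  have domain: "x_seq t s i \<in> edom \<Psi>" "s (int i) \<in> edom \<Psi>" for i
    using x_seq_in_edom[OF \<Psi>(1) algorithm optimality] iterate_in_edom[OF optimality] by auto
  have finite: "\<bar>f (A w)\<bar> \<noteq> \<infinity> \<and> \<bar>\<Psi> w\<bar> \<noteq> \<infinity>" if "w \<in> edom \<Psi>" for w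
    using that \<Psi>(2) convex_fun_finite_on_edom[OF \<Psi>(1) that]
    by (fastforce simp: dom_subdiff_def subdiff_def)
  define T where "T = (\<Sum>i<k. t i)"
  define \<theta> where "\<theta> = theta_seq t k"
  define F where "F = (\<lambda>w. real_of_ereal (f (A w) + \<Psi> w))"
  have F_eq: "real_of_ereal (f (A w) + \<Psi> w) = F w" for w
    by (simp add: F_def)
  define m where "m = real_of_ereal (f (A (y k))) + (g k (A (s (int k))) - g k (A (y k)))
    + real_of_ereal (\<Psi> (s (int k)))"
  have T: "0 \<le> T"
    using t by (simp add: T_def sum_nonneg less_imp_le)
  have \<theta>: "\<theta> = t k / (T + t k)" "0 < \<theta>"
    using theta_seq_bounds[where t = t, OF t]
    by (simp_all add: \<theta>_def theta_seq_def T_def lessThan_Suc_atMost[symmetric])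
  have "D_fun A f \<Psi> (g k) (x_seq t s k) (y k) (s (int k)) \<theta>
      = ereal (F (x_seq t s (Suc k)) - (1 - \<theta>) * F (x_seq t s k) - \<theta> * m)"
    unfolding F_def m_def \<theta>_def x_seq_Suc[where t = t, OF t]
  proof (rule D_fun_linear_model[OF A subgradient])
    fix w
    assume "w \<in> {x_seq t s k, s (int k),
      x_seq t s k + theta_seq t k *\<^sub>R (s (int k) - x_seq t s k)}"
    then have "w \<in> edom \<Psi>"
      using domain(1)[of k] domain(1)[of "Suc k"] domain(2)[of k]
      by (auto simp: x_seq_Suc[where t = t, OF t])
    then show "\<bar>f (A w)\<bar> \<noteq> \<infinity> \<and> \<bar>\<Psi> w\<bar> \<noteq> \<infinity>"
      by (rule finite)
  qed
  moreover obtain d where d: "bregman h (s (int k)) (s (int k - 1)) = ereal d"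
    using bregman_finite[OF h(1)] has_gradient_grad[OF h(2)]
    by (cases "h (s (int k))") (auto simp: has_gradient_def)
  ultimately have "t k * (F (x_seq t s (Suc k)) - (1 - \<theta>) * F (x_seq t s k) - \<theta> * m) / \<theta> - d \<le> \<epsilon> k"
    using step[of k] \<theta>(2) by (simp add: \<theta>_def)
  moreover have "t k * (F (x_seq t s (Suc k)) - (1 - \<theta>) * F (x_seq t s k) - \<theta> * m) / \<theta>
      = (T + t k) * F (x_seq t s (Suc k)) - T * F (x_seq t s k) - t k * m"
  proof -
    have weights: "(T + t k) * \<theta> = t k" "(T + t k) * (1 - \<theta>) = T" "t k / \<theta> = T + t k"
      using t[of k] T by (simp_all add: \<theta>(1) field_simps)
    have "t k * (F (x_seq t s (Suc k)) - (1 - \<theta>) * F (x_seq t s k) - \<theta> * m) / \<theta>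
        = t k / \<theta> * (F (x_seq t s (Suc k)) - (1 - \<theta>) * F (x_seq t s k) - \<theta> * m)"
      by simp
    also have "\<dots> = (T + t k) * F (x_seq t s (Suc k)) - (T + t k) * (1 - \<theta>) * F (x_seq t s k)
        - (T + t k) * \<theta> * m"
      unfolding weights(3) mult.assoc right_diff_distrib[of "T + t k" _ "\<theta> * m"]
        right_diff_distrib[of "T + t k" "F (x_seq t s (Suc k))"] ..
    finally show ?thesis
      by (simp only: weights)
  qed
  ultimately have "(T + t k) * F (x_seq t s (Suc k)) \<le> T * F (x_seq t s k) + t k * m + d + \<epsilon> k"
    by simp
  moreover have "t k * (g k (A (s (int k))) + real_of_ereal (\<Psi> (s (int k)))) + d
      + real_of_ereal (bregman h z (s (int k)))
      \<le> t k * (g k (A z) + b) + real_of_ereal (bregman h z (s (int k - 1)))"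
    using bregman_prox_inequality[OF h z(2) v(1) z(1) t, where l = "\<lambda>w. g k (A w)"] v(2) d by simp
  ultimately show ?case
    using Suc.IH unfolding m_def
    by (simp add: T_def[symmetric] F_eq distrib_left right_diff_distrib)
qed

theorem corollary1:
  fixes A :: "'a::real_tvs \<Rightarrow> 'b::real_tvs"
    and f :: "'b \<Rightarrow> ereal" and \<Psi> h :: "'a \<Rightarrow> ereal"
    and y :: "nat \<Rightarrow> 'a" and g :: "nat \<Rightarrow> 'b \<Rightarrow> real"
    and t \<epsilon> :: "nat \<Rightarrow> real" and s :: "int \<Rightarrow> 'a"
  assumes "linear A"
    and "\<And>v. v \<in> cdual \<Longrightarrow> adjoint_map A v \<in> cdual"
    and "closed_convex_fun f"
    and "closed_convex_fun \<Psi>"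
    and "edom \<Psi> \<subseteq> dom_subdiff (f \<circ> A)"
    and "reference_fun h"
    and "edom \<Psi> \<subseteq> closure (edom h)"
    and "meta_algorithm A f \<Psi> h y g t s"
    and "optimality_conditions A \<Psi> h g t s"
    and "\<And>k. ereal (t k) * D_fun A f \<Psi> (g k) (x_seq t s k) (y k) (s (int k)) (theta_seq t k)
                / ereal (theta_seq t k)
              - bregman h (s (int k)) (s (int k - 1)) \<le> ereal (\<epsilon> k)"
  shows "(\<forall>k\<ge>1. f (A (x_seq t s k)) + \<Psi> (x_seq t s k) + conjugate f (u_seq t g k)
              + conjugate (\<lambda>z. \<Psi> z + d_seq h t s k z) (\<lambda>x. - adjoint_map A (u_seq t g k) x)
            \<le> ereal ((\<Sum>i<k. \<epsilon> i) / (\<Sum>i<k. t i)))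
    \<and> (\<forall>k\<ge>1. \<forall>x. f (A (x_seq t s k)) + \<Psi> (x_seq t s k) - (f (A x) + \<Psi> x)
            \<le> (bregman h x (x_seq t s 0) + ereal (\<Sum>i<k. \<epsilon> i)) / ereal (\<Sum>i<k. t i))"
proof -
  have t: "0 < t i" and subgradient: "g i \<in> subdiff f (A (y i))" for i
    using assms(8) by (simp_all add: meta_algorithm_def)
  have \<Psi>: "convex_fun \<Psi>" and h: "convex_fun h"
    using assms(4,6) by (simp_all add: closed_convex_fun_def reference_fun_def)
  have h_at: "differentiable_at h (s (int k - 1))" for k
    using assms(9) by (simp add: optimality_conditions_def)
  have domain: "x_seq t s k \<in> edom \<Psi>" for k
    using x_seq_in_edom[OF \<Psi> assms(8,9)] .
  have finite: "\<exists>a b. f (A w) = ereal a \<and> \<Psi> w = ereal b" if "w \<in> edom \<Psi>" for w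
  proof -
    have "\<bar>f (A w)\<bar> \<noteq> \<infinity>"
      using that assms(5) by (fastforce simp: dom_subdiff_def subdiff_def)
    then show ?thesis
      using convex_fun_finite_on_edom[OF \<Psi> that] by (cases "f (A w)") auto
  qed
  have bregman_infinite: "bregman h w (s (-1)) = \<infinity>" if "h w = \<infinity>" for w
    using that has_gradient_grad[OF h_at[of 0]]
    by (cases "h (s (-1))") (auto simp: has_gradient_def bregman_def)
  have x_seq_0: "x_seq t s 0 = s (-1)"
    by (simp add: x_seq_def)
  define T where "T = (\<lambda>k. \<Sum>i<k. t i)"
  define F where "F = (\<lambda>k. real_of_ereal (f (A (x_seq t s k)) + \<Psi> (x_seq t s k)))"
  define P where "P = (\<lambda>k. \<Sum>i<k. t i * (real_of_ereal (f (A (y i))) - g i (A (y i))))"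
  have T_sum: "(\<Sum>i<k. t i) = T k" for k
    by (simp add: T_def)
  have T: "0 < T k" if "1 \<le> k" for k
    unfolding T_def using t that by (auto intro!: sum_pos simp: lessThan_empty_iff)
  have F: "f (A (x_seq t s k)) + \<Psi> (x_seq t s k) = ereal (F k)" for k
    using finite[OF domain[of k]] by (auto simp: F_def)
  \<comment> \<open>The terminal Bregman distance is nonnegative and dropped, and the averaged model is written
    through its slope \<open>u_seq t g k\<close> and its unnormalized intercept \<open>P k\<close>.\<close>
  have model: "T k * F k \<le> P k + T k * (u_seq t g k (A w) + b)
      + real_of_ereal (bregman h w (s (-1))) + (\<Sum>i<k. \<epsilon> i)"
    if k: "1 \<le> k" and w: "\<Psi> w = ereal b" "h w = ereal c" for k w b c
  proof -
    have "(\<Sum>i<k. t i * g i (A w)) = T k * u_seq t g k (A w)"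
      using T[OF k] by (simp add: u_seq_def T_def)
    then have "(\<Sum>i<k. t i * (real_of_ereal (f (A (y i))) + (g i (A w) - g i (A (y i))) + b))
        = P k + T k * (u_seq t g k (A w) + b)"
      unfolding distrib_left P_def T_def
      by (simp add: sum.distrib sum_distrib_right[symmetric] right_diff_distrib distrib_left
          sum_subtractf)
    then show ?thesis
      using weighted_objective_le_model[OF assms(1) \<Psi> assms(5,8,9,10) w, of k]
        bregman_nonneg[OF h h_at w(2), of k]
      by (simp add: T_def F_def)
  qed
  have gap: "f (A (x_seq t s k)) + \<Psi> (x_seq t s k) + conjugate f (u_seq t g k)
        + conjugate (\<lambda>z. \<Psi> z + d_seq h t s k z) (\<lambda>x. - adjoint_map A (u_seq t g k) x)
      \<le> ereal ((\<Sum>i<k. \<epsilon> i) / (\<Sum>i<k. t i))" if k: "1 \<le> k" for k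
  proof -
    have "conjugate (\<lambda>z. \<Psi> z + d_seq h t s k z) (\<lambda>x. - adjoint_map A (u_seq t g k) x)
        \<le> ereal ((\<Sum>i<k. \<epsilon> i) / T k + P k / T k - F k)"
      unfolding conjugate_def
    proof (rule SUP_least)
      fix w
      show "ereal (- adjoint_map A (u_seq t g k) w) - (\<Psi> w + d_seq h t s k w)
          \<le> ereal ((\<Sum>i<k. \<epsilon> i) / T k + P k / T k - F k)"
      proof (cases "\<Psi> w = \<infinity> \<or> h w = \<infinity>")
        \<comment> \<open>Points where \<open>\<Psi> + d_k\<close> is infinite contribute \<open>-\<infinity>\<close> to the supremum.\<close>
        case True
        then have "\<Psi> w + d_seq h t s k w = \<infinity>"
        proof
          assume "h w = \<infinity>"
          then show ?thesis
            using T[OF k] by (simp add: d_seq_def bregman_infinite T_def)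
        qed simp
        then show ?thesis
          by (simp only:) simp
      next
        case False
        then obtain b c where w: "\<Psi> w = ereal b" "h w = ereal c"
          using \<Psi> h by (cases "\<Psi> w"; cases "h w") (auto simp: convex_fun_def)
        obtain d where d: "bregman h w (s (-1)) = ereal d"
          using bregman_finite[OF h_at[of 0] w(2)] by simp
        have "T k * F k \<le> P k + T k * (u_seq t g k (A w) + b) + d + (\<Sum>i<k. \<epsilon> i)"
          using model[OF k w] d by simp
        then have "F k \<le> P k / T k + (u_seq t g k (A w) + b) + d / T k + (\<Sum>i<k. \<epsilon> i) / T k"
          using T[OF k] by (simp add: field_simps)
        then show ?thesis
          using T[OF k] by (simp add: d_seq_def d w T_sum adjoint_map_def)
      qed
    qed
    moreover have "conjugate f (u_seq t g k) \<le> ereal (- P k / T k)"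
      using conjugate_u_seq_le[OF subgradient t k] by (simp add: P_def T_def)
    ultimately have "ereal (F k) + conjugate f (u_seq t g k)
        + conjugate (\<lambda>z. \<Psi> z + d_seq h t s k z) (\<lambda>x. - adjoint_map A (u_seq t g k) x)
        \<le> ereal (F k) + ereal (- P k / T k) + ereal ((\<Sum>i<k. \<epsilon> i) / T k + P k / T k - F k)"
      by (intro add_mono order_refl)
    then show ?thesis
      by (simp add: F T_def)
  qed
  have primal: "f (A (x_seq t s k)) + \<Psi> (x_seq t s k) - (f (A x) + \<Psi> x)
      \<le> (bregman h x (x_seq t s 0) + ereal (\<Sum>i<k. \<epsilon> i)) / ereal (\<Sum>i<k. t i)"
    if k: "1 \<le> k" for k x
  proof (cases "\<Psi> x = \<infinity> \<or> h x = \<infinity>")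
    case True
    then show ?thesis
    proof
      assume "\<Psi> x = \<infinity>"
      then show ?thesis
        by (simp add: F)
    next
      assume "h x = \<infinity>"
      then show ?thesis
        using T[OF k] by (simp add: x_seq_0 bregman_infinite T_sum)
    qed
  next
    case False
    then obtain b c where x: "\<Psi> x = ereal b" "h x = ereal c"
      using \<Psi> h by (cases "\<Psi> x"; cases "h x") (auto simp: convex_fun_def)
    obtain a where a: "f (A x) = ereal a"
      using finite[of x] x by (auto simp: edom_def)
    obtain d where d: "bregman h x (s (-1)) = ereal d"
      using bregman_finite[OF h_at[of 0] x(2)] by simp
    have "ereal (u_seq t g k (A x)) - f (A x) \<le> conjugate f (u_seq t g k)"
      unfolding conjugate_def by (rule SUP_upper) simp
    also have "\<dots> \<le> ereal (- P k / T k)"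
      using conjugate_u_seq_le[OF subgradient t k] by (simp add: P_def T_def)
    finally have "P k + T k * u_seq t g k (A x) \<le> T k * a"
      using T[OF k] by (simp add: a field_simps)
    then have "T k * F k \<le> T k * (a + b) + d + (\<Sum>i<k. \<epsilon> i)"
      using model[OF k x] by (simp add: d algebra_simps)
    then have "F k - (a + b) \<le> (d + (\<Sum>i<k. \<epsilon> i)) / T k"
      using T[OF k] by (simp add: field_simps)
    then show ?thesis
      using T[OF k] by (simp add: F x a x_seq_0 d T_sum)
  qed
  show ?thesis
    using gap primal by blast
qed

end
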